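(* Let $T\subset\mathbb R^2$ be a closed axis-parallel square with vertices $\mathbf x_1$ (lower left), $\mathbf x_2$ (lower right), $\mathbf x_3$ (upper right), $\mathbf x_4$ (upper left), and let $$V_4(T)=\operatorname{span}\{P_4(T),\ b_5,b_6,b_7,b_8,b_{12},b_{14},b_{17},b_{18},b_{20}\},$$ where $b_1,\dots,b_{25}$ is the dual basis of $Q_4(T)$ described in the context. Then the following 24 degrees of freedom uniquely determine the functions in $V_4(T)$ (that is, for every choice of prescribed real values of these degrees of freedom there is exactly one $p\in V_4(T)$ attaining them): (1) $p(\mathbf x_i),\ \partial_x p(\mathbf x_i),\ \partial_y p(\mathbf x_i),\ \partial_{xy}p(\mathbf x_i)$, $i=1,2,3,4$; (2) $p\big(\tfrac{\mathbf x_1+\mathbf x_2}{2}\big),\ \partial_y p\big(\tfrac{\mathbf x_1+\mathbf x_2}{2}\big),\ p\big(\tfrac{\mathbf x_2+\mathbf x_3}{2}\big),\ \partial_x p\big(\tfrac{\mathbf x_2+\mathbf x_3}{2}\big)$; (3) $p\big(\tfrac{\mathbf x_4+\mathbf x_3}{2}\big),\ \partial_y p\big(\tfrac{\mathbf x_4+\mathbf x_3}{2}\big),\ p\big(\tfrac{\mathbf x_1+\mathbf x_4}{2}\big),\ \partial_x p\big(\tfrac{\mathbf x_1+\mathbf x_4}{2}\big)$.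
   Context: $P_k(T)$ is the space of real polynomials in $(x,y)$ of total degree at most $k$ on $T$; $Q_k(T)$ is the space of polynomials of degree at most $k$ in each variable separately. The 25 degrees of freedom $F_1,\dots,F_{25}$ of the $C^1$-$Q_4$ Bogner-Fox-Schmit element on $T$ are numbered as follows. For $i=1,2,3,4$: $F_{4i-3}(p)=p(\mathbf x_i)$, $F_{4i-2}(p)=\partial_xp(\mathbf x_i)$, $F_{4i-1}(p)=\partial_yp(\mathbf x_i)$, $F_{4i}(p)=\partial_{xy}p(\mathbf x_i)$. Then $F_{17}(p)=p(\frac{\mathbf x_1+\mathbf x_2}2)$, $F_{18}(p)=\partial_yp(\frac{\mathbf x_1+\mathbf x_2}2)$, $F_{19}(p)=p(\frac{\mathbf x_2+\mathbf x_3}2)$, $F_{20}(p)=\partial_xp(\frac{\mathbf x_2+\mathbf x_3}2)$, $F_{21}(p)=p(\frac{\mathbf x_4+\mathbf x_3}2)$, $F_{22}(p)=\partial_yp(\frac{\mathbf x_4+\mathbf x_3}2)$, $F_{23}(p)=p(\frac{\mathbf x_1+\mathbf x_4}2)$, $F_{24}(p)=\partial_xp(\frac{\mathbf x_1+\mathbf x_4}2)$, and $F_{25}(p)=p(\frac{\mathbf x_1+\mathbf x_2+\mathbf x_3+\mathbf x_4}4)$. These 25 functionals are unisolvent on $Q_4(T)$, and $b_1,\dots,b_{25}\in Q_4(T)$ denotes the dual basis: $F_m(b_n)=\delta_{mn}$. *)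

theory Defs
  imports "HOL-Analysis.Analysis" "HOL-Library.Function_Algebras"
begin

text \<open>
  A polynomial on a square \<open>T\<close> is represented by its unique polynomial extension to the whole
  plane, so that partial derivatives at boundary points of \<open>T\<close> are ordinary derivatives.
  Real-valued functions on the plane form a vector space under the pointwise operations.
\<close>

global_interpretation plane_fun: vector_space
  "\<lambda>(c::real) (f :: real \<times> real \<Rightarrow> real) z. c * f z"
  by unfold_locales (auto simp: algebra_simps)

definition Pspace :: "nat \<Rightarrow> (real \<times> real \<Rightarrow> real) set" where
  "Pspace k = {p. \<exists>c :: nat \<Rightarrow> nat \<Rightarrow> real.
     p = (\<lambda>(s, t). \<Sum>(i, j) \<in> {(i, j). i + j \<le> k}. c i j * s ^ i * t ^ j)}"

definition Qspace :: "nat \<Rightarrow> (real \<times> real \<Rightarrow> real) set" where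
  "Qspace k = {p. \<exists>c :: nat \<Rightarrow> nat \<Rightarrow> real.
     p = (\<lambda>(s, t). \<Sum>(i, j) \<in> {..k} \<times> {..k}. c i j * s ^ i * t ^ j)}"

definition pdx :: "(real \<times> real \<Rightarrow> real) \<Rightarrow> real \<times> real \<Rightarrow> real" where
  "pdx p = (\<lambda>(s, t). deriv (\<lambda>u. p (u, t)) s)"

definition pdy :: "(real \<times> real \<Rightarrow> real) \<Rightarrow> real \<times> real \<Rightarrow> real" where
  "pdy p = (\<lambda>(s, t). deriv (\<lambda>u. p (s, u)) t)"

definition pdxy :: "(real \<times> real \<Rightarrow> real) \<Rightarrow> real \<times> real \<Rightarrow> real" where
  "pdxy p = pdy (pdx p)"

definition square_with_vertices :: "(real \<times> real) set \<Rightarrow> (nat \<Rightarrow> real \<times> real) \<Rightarrow> bool" where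
  "square_with_vertices T x \<longleftrightarrow> (\<exists>a b h. h > 0 \<and> T = {a..a + h} \<times> {b..b + h} \<and>
     x 1 = (a, b) \<and> x 2 = (a + h, b) \<and> x 3 = (a + h, b + h) \<and> x 4 = (a, b + h))"

definition bfs_dofs :: "(nat \<Rightarrow> real \<times> real) \<Rightarrow> (real \<times> real \<Rightarrow> real) \<Rightarrow> real list" where
  "bfs_dofs x p =
     concat (map (\<lambda>i. [p (x i), pdx p (x i), pdy p (x i), pdxy p (x i)]) [1, 2, 3, 4]) @
     [p (midpoint (x 1) (x 2)), pdy p (midpoint (x 1) (x 2)),
      p (midpoint (x 2) (x 3)), pdx p (midpoint (x 2) (x 3)),
      p (midpoint (x 4) (x 3)), pdy p (midpoint (x 4) (x 3)),
      p (midpoint (x 1) (x 4)), pdx p (midpoint (x 1) (x 4)),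
      p ((x 1 + x 2 + x 3 + x 4) /\<^sub>R 4)]"

text \<open>Degrees of freedom are numbered from 1 to 25, list positions from 0;
  number 25 is the value at the centre of the square.\<close>

definition dof :: "(nat \<Rightarrow> real \<times> real) \<Rightarrow> nat \<Rightarrow> (real \<times> real \<Rightarrow> real) \<Rightarrow> real" where
  "dof x m p = bfs_dofs x p ! (m - 1)"

text \<open>
  The definite description is well-defined for \<open>n \<in> {1..25}\<close> because the 25 functionals are unisolvent
  on \<open>Qspace 4\<close>.
\<close>

definition bfs_basis :: "(nat \<Rightarrow> real \<times> real) \<Rightarrow> nat \<Rightarrow> real \<times> real \<Rightarrow> real" where
  "bfs_basis x n = (THE q. q \<in> Qspace 4 \<and> (\<forall>m\<in>{1..25}. dof x m q = (if m = n then 1 else 0)))"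

definition V4 :: "(nat \<Rightarrow> real \<times> real) \<Rightarrow> (real \<times> real \<Rightarrow> real) set" where
  "V4 x = plane_fun.span (Pspace 4 \<union> bfs_basis x ` {5, 6, 7, 8, 12, 14, 17, 18, 20})"

end

theory Submission imports Defs begin

text \<open>
  Every element of \<open>V4 x\<close> is \<open>q\<close> plus a combination of the nine added dual functions, with \<open>q\<close> in
  \<open>P\<^sub>4\<close>. The added functions do not affect the 15 remaining functionals among
  \<open>F\<^sub>1, \<dots>, F\<^sub>2\<^sub>4\<close>, so these determine \<open>q\<close> provided they are unisolvent on \<open>P\<^sub>4\<close>, and the other nine
  values can then be adjusted freely. Unisolvence on \<open>P\<^sub>4\<close> is a 15 by 15 linear system, solved in the
  coordinates \<open>((s - a) / r, (t - b) / r)\<close>, in which the square becomes \<open>[0, 2]\<^sup>2\<close>. The dual basis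
  of \<open>Q\<^sub>4\<close> exists because its 25 functionals are tensor products of five Hermite functionals on
  univariate quartics.
\<close>

section \<open>Polynomials under translation and a common scaling of both variables\<close>

lemma affine_power_expand:
  fixes u w s :: real
  assumes "i \<le> N"
  shows "(u + w * s) ^ i = (\<Sum>k\<le>N. (of_nat (i choose k) * w ^ k * u ^ (i - k)) * s ^ k)"
proof -
  have "(u + w * s) ^ i = (\<Sum>k\<le>i. of_nat (i choose k) * (w * s) ^ k * u ^ (i - k))"
    using binomial_ring[of "w * s" u i] by (simp add: add.commute)
  also have "\<dots> = (\<Sum>k\<le>N. of_nat (i choose k) * (w * s) ^ k * u ^ (i - k))"
    by (rule sum.mono_neutral_left) (use assms in auto)
  finally show ?thesis by (simp add: power_mult_distrib mult_ac)
qed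

text \<open>The binomial theorem turns each monomial into monomials with exponents componentwise
  below \<open>(i, j)\<close>, and downward closure keeps these in \<open>I\<close>. Both the
  triangle \<open>i + j \<le> 4\<close> and the square of exponents up to 4 are such index
  sets.\<close>

lemma affine_substitution:
  fixes c :: "nat \<Rightarrow> nat \<Rightarrow> real"
  assumes fin: "finite I"
    and down: "\<And>i j k l. (i, j) \<in> I \<Longrightarrow> k \<le> i \<Longrightarrow> l \<le> j \<Longrightarrow> (k, l) \<in> I"
  shows "\<exists>c'. \<forall>s t. (\<Sum>(i, j)\<in>I. c i j * (u + w * s) ^ i * (v + w * t) ^ j)
    = (\<Sum>(i, j)\<in>I. c' i j * s ^ i * t ^ j)"
proof -
  define A where "A z i k = of_nat (i choose k) * w ^ k * z ^ (i - k)" for z :: real and i k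
  have A0: "A z i k = 0" if "k > i" for z i k using that by (simp add: A_def)
  \<comment> \<open>A box containing \<open>I\<close> lets all powers be expanded over one common
    range before the sum is cut back to \<open>I\<close>.\<close>
  obtain N where N: "\<And>i j. (i, j) \<in> I \<Longrightarrow> i \<le> N \<and> j \<le> N"
  proof -
    have "finite (fst ` I \<union> snd ` I)" using fin by simp
    then obtain N where "\<forall>n\<in>fst ` I \<union> snd ` I. n \<le> N"
      using finite_nat_set_iff_bounded_le by blast
    then show ?thesis using that by (metis UnI1 UnI2 fst_conv image_eqI snd_conv)
  qed
  have mono: "(u + w * s) ^ i * (v + w * t) ^ j = (\<Sum>(k, l)\<in>I. A u i k * A v j l * s ^ k * t ^ l)"
    if ij: "(i, j) \<in> I" for i j s t
  proof -
    have "(u + w * s) ^ i * (v + w * t) ^ j = (\<Sum>k\<le>N. A u i k * s ^ k) * (\<Sum>l\<le>N. A v j l * t ^ l)"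
      using N[OF ij] by (simp add: affine_power_expand[of i N] affine_power_expand[of j N] A_def)
    also have "\<dots> = (\<Sum>(k, l)\<in>{..N} \<times> {..N}. A u i k * A v j l * s ^ k * t ^ l)"
      by (simp add: sum_product sum.cartesian_product mult_ac)
    also have "\<dots> = (\<Sum>(k, l)\<in>I. A u i k * A v j l * s ^ k * t ^ l)"
    proof (rule sum.mono_neutral_right)
      show "\<forall>z\<in>{..N} \<times> {..N} - I. (case z of (k, l) \<Rightarrow> A u i k * A v j l * s ^ k * t ^ l) = 0"
      proof clarify
        fix k l assume "(k, l) \<notin> I"
        then have "k > i \<or> l > j" using down[OF ij, of k l] by (meson not_le)
        then show "A u i k * A v j l * s ^ k * t ^ l = 0" using A0 by auto
      qed
    qed (use N in auto)
    finally show ?thesis .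
  qed
  have "(\<Sum>(i, j)\<in>I. c i j * (u + w * s) ^ i * (v + w * t) ^ j)
      = (\<Sum>(k, l)\<in>I. (\<Sum>(i, j)\<in>I. c i j * A u i k * A v j l) * s ^ k * t ^ l)" for s t
  proof -
    have "(\<Sum>(i, j)\<in>I. c i j * (u + w * s) ^ i * (v + w * t) ^ j)
      = (\<Sum>z\<in>I. \<Sum>y\<in>I. c (fst z) (snd z) *
          (A u (fst z) (fst y) * A v (snd z) (snd y) * s ^ fst y * t ^ snd y))"
      by (rule sum.cong) (use mono in \<open>auto simp: mult.assoc sum_distrib_left case_prod_beta\<close>)
    also have "\<dots> = (\<Sum>y\<in>I. \<Sum>z\<in>I. c (fst z) (snd z) *
          (A u (fst z) (fst y) * A v (snd z) (snd y) * s ^ fst y * t ^ snd y))"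
      by (rule sum.swap)
    also have "\<dots> = (\<Sum>(k, l)\<in>I. (\<Sum>(i, j)\<in>I. c i j * A u i k * A v j l) * s ^ k * t ^ l)"
      by (simp add: case_prod_beta sum_distrib_left sum_distrib_right mult_ac)
    finally show ?thesis .
  qed
  then show ?thesis
    by (intro exI[of _ "\<lambda>k l. \<Sum>(i, j)\<in>I. c i j * A u i k * A v j l"] allI)
qed

section \<open>Univariate Hermite functionals on quartics\<close>

text \<open>Only the orders 0 and 1 occur. For \<open>i = 0\<close> the truncated exponent
  \<open>i - 1\<close> does no harm, because the factor \<open>of_nat i\<close> is zero.\<close>

definition monom_deriv :: "nat \<Rightarrow> nat \<Rightarrow> real \<Rightarrow> real" where
  "monom_deriv d i u = (if d = 0 then u ^ i else of_nat i * u ^ (i - 1))"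

text \<open>
  The one-dimensional degrees of freedom on quartics: value and derivative at \<open>0\<close>, value and
  derivative at \<open>2\<close>, value at \<open>1\<close>. The 25 planar functionals are their tensor products.
\<close>

definition node :: "nat \<Rightarrow> real" where
  "node k = [0, 0, 2, 2, 1] ! k"

definition node_order :: "nat \<Rightarrow> nat" where
  "node_order k = [0, 1, 0, 1, 0] ! k"

definition hermite_functional :: "nat \<Rightarrow> nat \<Rightarrow> real" where
  "hermite_functional k i = monom_deriv (node_order k) i (node k)"

text \<open>Row \<open>k\<close> lists, by ascending powers, the quartic Hermite basis polynomial
  belonging to functional \<open>k\<close>; the last row is t^2 (t - 2)^2.\<close>

definition hermite_dual :: "nat \<Rightarrow> nat \<Rightarrow> real" where
  "hermite_dual k i =
     [[1, 0, -11/4, 9/4, -1/2], [0, 1, -2, 5/4, -1/4], [0, 0, -5/4, 7/4, -1/2],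
      [0, 0, 1/2, -3/4, 1/4], [0, 0, 4, -4, 1]] ! k ! i"

lemmas hermite_simps = hermite_functional_def monom_deriv_def node_def node_order_def

lemma hermite_dual:
  assumes "k \<le> 4" "k' \<le> 4"
  shows "(\<Sum>i\<le>4. hermite_dual k i * hermite_functional k' i) = (if k = k' then 1 else 0)"
proof -
  have "k \<in> {0, 1, 2, 3, 4}" "k' \<in> {0, 1, 2, 3, 4}" using assms by auto
  then show ?thesis
    by (auto simp: hermite_simps hermite_dual_def eval_nat_numeral)
qed

text \<open>Double zeros at 0 and 2 leave a multiple of t^2 (t - 2)^2, and the value at 1 kills it.
  Here this is carried out as elimination in a 5 by 5 system.\<close>

lemma hermite_unisolvent:
  assumes "\<And>k. k \<le> 4 \<Longrightarrow> (\<Sum>i\<le>4. c i * hermite_functional k i) = 0" and "i \<le> 4"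
  shows "c i = 0"
proof -
  have "i \<in> {0, 1, 2, 3, 4}" using assms(2) by auto
  then show ?thesis
    using assms(1)[of 0] assms(1)[of 1] assms(1)[of 2] assms(1)[of 3] assms(1)[of 4]
    by (auto simp: hermite_simps eval_nat_numeral)
qed

section \<open>Planar functionals as tensor products acting on coefficient arrays\<close>

text \<open>The entries are the 25 functionals in their given order: four at each vertex,
  counterclockwise from the lower left, then the bottom, right, top and left midpoints, then the
  centre. The first component acts in s, the second in t.\<close>

definition dof_pair :: "nat \<Rightarrow> nat \<times> nat" where
  "dof_pair m = [(0,0), (1,0), (0,1), (1,1), (2,0), (3,0), (2,1), (3,1), (2,2), (3,2), (2,3), (3,3),
     (0,2), (1,2), (0,3), (1,3), (4,0), (4,1), (2,4), (3,4), (4,2), (4,3), (0,4), (1,4), (4,4)] ! (m - 1)"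

definition ref_dof :: "nat \<Rightarrow> (nat \<Rightarrow> nat \<Rightarrow> real) \<Rightarrow> real" where
  "ref_dof m c = (case dof_pair m of (k, l) \<Rightarrow>
     \<Sum>i\<le>4. \<Sum>j\<le>4. c i j * hermite_functional k i * hermite_functional l j)"

lemma dof_cases:
  assumes "m \<in> {1..25}"
  shows "m \<in> {1,2,3,4,5,6,7,8,9,10,11,12,13,14,15,16,17,18,19,20,21,22,23,24,25::nat}"
  using assms by (simp; presburger)

lemma dof_pair_le: "m \<in> {1..25} \<Longrightarrow> fst (dof_pair m) \<le> 4 \<and> snd (dof_pair m) \<le> 4"
  by (drule dof_cases) (auto simp: dof_pair_def)

lemma dof_pair_image: "dof_pair ` {1..25} = {..4} \<times> {..4}"
proof -
  have "dof_pair ` set [1..<26] = set [0..<5] \<times> set [0..<5]"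
    by code_simp
  moreover have "set [1..<26] = {1..25}" "set [0..<5] = {..4::nat}" by auto
  ultimately show ?thesis by metis
qed

text \<open>A map from 25 numbers onto 25 pairs is injective.\<close>

lemma dof_pair_inj: "inj_on dof_pair {1..25}"
  by (rule eq_card_imp_inj_on) (simp, simp only: dof_pair_image, simp)

lemma ref_dof_add: "ref_dof m (\<lambda>i j. c i j + d i j) = ref_dof m c + ref_dof m d"
  by (simp add: ref_dof_def case_prod_beta algebra_simps sum.distrib)

lemma ref_dof_scale: "ref_dof m (\<lambda>i j. a * c i j) = a * ref_dof m c"
  by (simp add: ref_dof_def case_prod_beta sum_distrib_left mult.assoc)

text \<open>The double sum factors into two univariate pairings, and injectivity of
  \<open>dof_pair\<close> turns equality of pairs into equality of numbers.\<close>

lemma ref_dof_dual: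
  assumes "m \<in> {1..25}" "n \<in> {1..25}"
  shows "ref_dof m (\<lambda>i j. hermite_dual (fst (dof_pair n)) i * hermite_dual (snd (dof_pair n)) j)
    = (if m = n then 1 else 0)"
proof -
  obtain k l where n: "dof_pair n = (k, l)" by fastforce
  obtain k' l' where m: "dof_pair m = (k', l')" by fastforce
  have "ref_dof m (\<lambda>i j. hermite_dual (fst (dof_pair n)) i * hermite_dual (snd (dof_pair n)) j)
    = (\<Sum>i\<le>4. hermite_dual k i * hermite_functional k' i) * (\<Sum>j\<le>4. hermite_dual l j * hermite_functional l' j)"
    by (simp add: ref_dof_def n m sum_product mult_ac)
  also have "\<dots> = (if k = k' \<and> l = l' then 1 else 0)"
    using dof_pair_le[OF assms(1)] dof_pair_le[OF assms(2)] n m by (simp add: hermite_dual)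
  also have "\<dots> = (if m = n then 1 else 0)"
    using inj_onD[OF dof_pair_inj, of m n] assms n m by auto
  finally show ?thesis .
qed

text \<open>Univariate unisolvence is used twice: for a fixed functional in t, the inner sums are
  the coefficients of a quartic in s and vanish; then each row of \<open>c\<close> is a quartic in
  t.\<close>

lemma ref_dof_unisolvent:
  assumes "\<And>m. m \<in> {1..25} \<Longrightarrow> ref_dof m c = 0" and "i \<le> 4" "j \<le> 4"
  shows "c i j = 0"
proof -
  have 0: "(\<Sum>i\<le>4. (\<Sum>j\<le>4. c i j * hermite_functional l j) * hermite_functional k i) = 0"
    if "k \<le> 4" "l \<le> 4" for k l
  proof -
    have "(k, l) \<in> dof_pair ` {1..25}" using that unfolding dof_pair_image by simp
    then obtain m where "m \<in> {1..25}" "dof_pair m = (k, l)" by force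
    then show ?thesis
      using assms(1)[of m] by (simp add: ref_dof_def sum_distrib_left mult_ac)
  qed
  have "(\<Sum>j\<le>4. c i j * hermite_functional l j) = 0" if "l \<le> 4" for l
    by (rule hermite_unisolvent[where i = i]) (use 0 that assms in auto)
  then show ?thesis by (rule hermite_unisolvent) (use assms in auto)
qed

section \<open>Unisolvence of fifteen functionals on polynomials of total degree 4\<close>

definition P4_dofs :: "nat set" where
  "P4_dofs = {1, 2, 3, 4, 9, 10, 11, 13, 15, 16, 19, 21, 22, 23, 24}"

lemma sum_atMost_4: "(\<Sum>i\<le>4. f i) = f 0 + f 1 + f 2 + f 3 + f (4::nat)" for f :: "nat \<Rightarrow> real"
  by (simp add: eval_nat_numeral)

text \<open>Elimination starts from the edge s = 0, which carries nine of the fifteen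
  functionals.\<close>

lemma P4_ref_unisolvent:
  assumes deg: "\<And>i j. i + j > 4 \<Longrightarrow> c i j = 0" and zero: "\<And>m. m \<in> P4_dofs \<Longrightarrow> ref_dof m c = 0"
  shows "c i j = 0"
proof (cases "i + j > 4")
  case False
  then have ij: "i \<in> {0, 1, 2, 3, 4}" "j \<in> {0, 1, 2, 3, 4}" by auto
  have deg': "c (Suc 0) 4 = 0" "c 2 3 = 0" "c 2 4 = 0" "c 3 2 = 0" "c 3 3 = 0" "c 3 4 = 0"
    "c 4 (Suc 0) = 0" "c 4 2 = 0" "c 4 3 = 0" "c 4 4 = 0" by (auto intro!: deg)
  note eqs = zero[unfolded P4_dofs_def ref_dof_def dof_pair_def hermite_simps sum_atMost_4]
  have low: "c 0 0 = 0" "c (Suc 0) 0 = 0" "c 0 (Suc 0) = 0" "c (Suc 0) (Suc 0) = 0"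
    using eqs[of 1] eqs[of 2] eqs[of 3] eqs[of 4] by (simp_all add: deg')
  \<comment> \<open>On s = 0 the polynomial is a quartic in t with zero value and slope at both ends
    and zero value at the midpoint.\<close>
  have col0: "c 0 2 = 0" "c 0 3 = 0" "c 0 4 = 0"
    using eqs[of 13] eqs[of 15] eqs[of 23] by (simp_all add: deg' low)
  \<comment> \<open>The s-derivative on s = 0 is a cubic in t: value and slope vanish at 0, the
    value at 1 and the slope at 2.\<close>
  have col1: "c (Suc 0) 2 = 0" "c (Suc 0) 3 = 0"
    using eqs[of 16] eqs[of 24] by (simp_all add: deg' low)
  \<comment> \<open>What is left is s^2 g with g of degree at most 2. On s = 2, g has a double zero
    at t = 2 and a zero at t = 1, so g = (s - 2) l with l affine. Then l vanishes at (2, 2) and (1,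
    2), as does its t-derivative, so l = 0.\<close>
  have "c 2 0 = 0" "c 2 (Suc 0) = 0" "c 2 2 = 0" "c 3 0 = 0" "c 3 (Suc 0) = 0" "c 4 0 = 0"
    using eqs[of 9] eqs[of 10] eqs[of 11] eqs[of 19] eqs[of 21] eqs[of 22]
    by (simp_all add: deg' low col0 col1)
  then show ?thesis
    using False ij by (auto simp: deg' low col0 col1)
qed (use deg in auto)

text \<open>The witness comes from inverting the 15 by 15 collocation matrix.\<close>

lemma P4_ref_interpolation:
  obtains c where "\<And>i j. i + j > 4 \<Longrightarrow> c i j = 0" and "\<And>m. m \<in> P4_dofs \<Longrightarrow> ref_dof m c = v m"
proof -
  define rows where "rows =
    [[v 1,
          v 3,
          - 11/4 * v 1 - 2 * v 3 - 5/4 * v 13 + 1/2 * v 15 + 4 * v 23,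
          9/4 * v 1 + 5/4 * v 3 + 7/4 * v 13 - 3/4 * v 15 - 4 * v 23,
          - 1/2 * v 1 - 1/4 * v 3 - 1/2 * v 13 + 1/4 * v 15 + v 23],
         [v 2,
          v 4,
          - 3/2 * v 2 - 11/8 * v 4 - 1/8 * v 16 + 3/2 * v 24,
          1/2 * v 2 + 3/8 * v 4 + 1/8 * v 16 - 1/2 * v 24],
         [- 9/4 * v 9 + 1/2 * v 10 + 3/2 * v 11 - 7/4 * v 13 + 5/2 * v 15 + v 16 + v 19 + 4 * v 21 - 4 * v 22 - v 23 - 2 * v 24,
          2 * v 2 + v 4 + v 9 - 5/4 * v 11 - v 13 - 3/4 * v 15 - 1/2 * v 16 - v 19 + 2 * v 22 + v 23 - 2 * v 24,
          - 1/2 * v 2 - 1/4 * v 4 - 1/4 * v 9 + 1/4 * v 11 + 1/4 * v 13 - 1/4 * v 15 - 1/4 * v 16 + 1/4 * v 19 - 1/4 * v 23 + 1/2 * v 24],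
         [- 5/4 * v 2 - 5/8 * v 4 + 7/4 * v 9 - 3/4 * v 10 - 1/2 * v 11 + 9/4 * v 13 - 3/2 * v 15 - 3/8 * v 16 - 4 * v 21 + 2 * v 22 + 5/2 * v 24,
          1/4 * v 11 + 3/4 * v 15 + 1/2 * v 16 - v 22],
         [1/4 * v 2 + 1/8 * v 4 - 1/2 * v 9 + 1/4 * v 10 - 1/2 * v 13 - 1/8 * v 16 + v 21 - 1/2 * v 24]]"
  \<comment> \<open>Row \<open>i\<close> has only \<open>5 - i\<close> entries, so the guard also
    keeps the list access in range.\<close>
  define c where "c i j = (if i + j \<le> 4 then rows ! i ! j else 0)" for i j
  have c_simps: "c 0 j = (if j \<le> 4 then rows ! 0 ! j else 0)"
    "c (Suc 0) j = (if j \<le> 3 then rows ! 1 ! j else 0)"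
    "c 2 j = (if j \<le> 2 then rows ! 2 ! j else 0)"
    "c 3 j = (if j \<le> 1 then rows ! 3 ! j else 0)"
    "c 4 j = (if j = 0 then rows ! 4 ! j else 0)" for j
    by (auto simp: c_def)
  show ?thesis
  proof
    show "c i j = 0" if "i + j > 4" for i j using that by (simp add: c_def)
    show "ref_dof m c = v m" if "m \<in> P4_dofs" for m
      using that unfolding P4_dofs_def
      by (auto simp: ref_dof_def dof_pair_def hermite_simps sum_atMost_4 c_simps rows_def)
  qed
qed

section \<open>Transfer from the reference square to the given square\<close>

locale bfs_square =
  fixes x :: "nat \<Rightarrow> real \<times> real" and a b r :: real
  assumes r: "r > 0"
    and x: "x 1 = (a, b)" "x 2 = (a + 2 * r, b)" "x 3 = (a + 2 * r, b + 2 * r)" "x 4 = (a, b + 2 * r)"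
begin

text \<open>For \<open>d\<close> and \<open>e\<close> in {0, 1} this is the partial derivative of
  order \<open>(d, e)\<close> of the polynomial with coefficients \<open>c\<close> in the scaled
  coordinates, chain-rule factors included. Differentiation thus becomes a change of
  parameter.\<close>

definition scaled_poly :: "nat \<Rightarrow> nat \<Rightarrow> (nat \<Rightarrow> nat \<Rightarrow> real) \<Rightarrow> real \<times> real \<Rightarrow> real" where
  "scaled_poly d e c = (\<lambda>(s, t). \<Sum>i\<le>4. \<Sum>j\<le>4.
     c i j * (monom_deriv d i ((s - a) / r) / r ^ d) * (monom_deriv e j ((t - b) / r) / r ^ e))"

lemma DERIV_monom: "((\<lambda>u. monom_deriv 0 i ((u - a') / r) / r ^ 0) has_real_derivative
    monom_deriv 1 i ((s - a') / r) / r ^ 1) (at s)"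
  using r unfolding monom_deriv_def by (auto intro!: derivative_eq_intros)

lemma pdx_scaled_poly: "pdx (scaled_poly 0 e c) = scaled_poly 1 e c"
  unfolding pdx_def scaled_poly_def fun_eq_iff split_paired_All prod.case
  by (intro allI DERIV_imp_deriv DERIV_sum DERIV_cmult DERIV_cmult_right DERIV_monom)

lemma pdy_scaled_poly: "pdy (scaled_poly d 0 c) = scaled_poly d 1 c"
  unfolding pdy_def scaled_poly_def fun_eq_iff split_paired_All prod.case
  by (intro allI DERIV_imp_deriv DERIV_sum DERIV_cmult DERIV_monom)

text \<open>The chain-rule factor between a functional on the actual square and its reference
  counterpart.\<close>

definition weight :: "nat \<Rightarrow> real" where
  "weight m = r ^ node_order (fst (dof_pair m)) * r ^ node_order (snd (dof_pair m))"

lemma weight_nonzero: "weight m \<noteq> 0"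
  using r by (simp add: weight_def)

lemma dof_scaled_poly:
  assumes "m \<in> {1..25}"
  shows "dof x m (scaled_poly 0 0 c) = ref_dof m c / weight m"
proof -
  have *: "scaled_poly d e c (a + r * u, b + r * v)
    = (\<Sum>i\<le>4. \<Sum>j\<le>4. c i j * monom_deriv d i u * monom_deriv e j v) / (r ^ d * r ^ e)" for d e u v
    using r by (simp add: scaled_poly_def sum_divide_distrib)
  have corners: "(a, b) = (a + r * 0, b + r * 0)" "(a + 2 * r, b) = (a + r * 2, b + r * 0)"
    "(a + 2 * r, b + 2 * r) = (a + r * 2, b + r * 2)" "(a, b + 2 * r) = (a + r * 0, b + r * 2)"
    by simp_all
  have midpoints: "midpoint (a, b) (a + 2 * r, b) = (a + r * 1, b + r * 0)"
    "midpoint (a + 2 * r, b) (a + 2 * r, b + 2 * r) = (a + r * 2, b + r * 1)"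
    "midpoint (a, b + 2 * r) (a + 2 * r, b + 2 * r) = (a + r * 1, b + r * 2)"
    "midpoint (a, b) (a, b + 2 * r) = (a + r * 0, b + r * 1)"
    "((a, b) + (a + 2 * r, b) + (a + 2 * r, b + 2 * r) + (a, b + 2 * r)) /\<^sub>R 4 = (a + r * 1, b + r * 1)"
    by (simp_all add: midpoint_def field_simps)
  have "dof x m (scaled_poly 0 0 c) = (case dof_pair m of (k, l) \<Rightarrow>
     scaled_poly (node_order k) (node_order l) c (a + r * node k, b + r * node l))"
    using dof_cases[OF assms]
    unfolding dof_def bfs_dofs_def list.map x pdxy_def pdx_scaled_poly pdy_scaled_poly
    \<comment> \<open>The midpoints come before the corners, since their left-hand sides contain the
      corner pairs.\<close>
    unfolding midpoints
    unfolding corners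
    by (auto simp: dof_pair_def node_def node_order_def)
  then show ?thesis
    by (simp add: * ref_dof_def hermite_functional_def weight_def case_prod_beta)
qed

text \<open>The two inclusions are \<open>affine_substitution\<close> for the scaling map and for
  its inverse.\<close>

lemma scaled_polys:
  assumes "finite I" "\<And>i j k l. (i, j) \<in> I \<Longrightarrow> k \<le> i \<Longrightarrow> l \<le> j \<Longrightarrow> (k, l) \<in> I"
  shows "{p. \<exists>c. p = (\<lambda>(s, t). \<Sum>(i, j)\<in>I. c i j * s ^ i * t ^ j)}
    = {p. \<exists>c. p = (\<lambda>(s, t). \<Sum>(i, j)\<in>I. c i j * ((s - a) / r) ^ i * ((t - b) / r) ^ j)}"
    (is "?L = ?R")
proof (intro equalityI subsetI)
  fix p assume "p \<in> ?L"
  then obtain c where p: "p = (\<lambda>(s, t). \<Sum>(i, j)\<in>I. c i j * s ^ i * t ^ j)" by blast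
  obtain c' where c': "\<And>s t. (\<Sum>(i, j)\<in>I. c i j * (a + r * s) ^ i * (b + r * t) ^ j)
    = (\<Sum>(i, j)\<in>I. c' i j * s ^ i * t ^ j)"
    using affine_substitution[where I = I and c = c and u = a and w = r and v = b, OF assms(1)] assms(2)
    by blast
  have "p = (\<lambda>(s, t). \<Sum>(i, j)\<in>I. c' i j * ((s - a) / r) ^ i * ((t - b) / r) ^ j)"
    using r by (simp add: p flip: c')
  then show "p \<in> ?R" by blast
next
  fix p assume "p \<in> ?R"
  then obtain c where p: "p = (\<lambda>(s, t). \<Sum>(i, j)\<in>I. c i j * ((s - a) / r) ^ i * ((t - b) / r) ^ j)"
    by blast
  obtain c' where c': "\<And>s t. (\<Sum>(i, j)\<in>I. c i j * (- a / r + 1 / r * s) ^ i * (- b / r + 1 / r * t) ^ j)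
    = (\<Sum>(i, j)\<in>I. c' i j * s ^ i * t ^ j)"
    using affine_substitution[where I = I and c = c and u = "- a / r" and w = "1 / r" and v = "- b / r",
        OF assms(1)] assms(2)
    by blast
  have "(s - a) / r = - a / r + 1 / r * s" for s a by (simp add: diff_divide_distrib)
  then have "p = (\<lambda>(s, t). \<Sum>(i, j)\<in>I. c' i j * s ^ i * t ^ j)"
    by (simp only: p c')
  then show "p \<in> ?L" by blast
qed

lemma scaled_poly_00:
  "scaled_poly 0 0 c = (\<lambda>(s, t). \<Sum>(i, j)\<in>{..4} \<times> {..4}. c i j * ((s - a) / r) ^ i * ((t - b) / r) ^ j)"
  by (simp add: scaled_poly_def monom_deriv_def sum.cartesian_product)

lemma Qspace_4: "Qspace 4 = range (scaled_poly 0 0)"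
  using scaled_polys[of "{..4} \<times> {..4}"] by (auto simp: Qspace_def scaled_poly_00)

lemma Pspace_4: "Pspace 4 = scaled_poly 0 0 ` {c. \<forall>i j. i + j > 4 \<longrightarrow> c i j = 0}"
proof -
  let ?I = "{(i, j). i + j \<le> (4::nat)}"
  have fin: "finite ?I" by (rule finite_subset[of _ "{..4} \<times> {..4}"]) auto
  have restrict: "(\<lambda>(s, t). \<Sum>(i, j)\<in>?I. c i j * ((s - a) / r) ^ i * ((t - b) / r) ^ j)
    = scaled_poly 0 0 (\<lambda>i j. if i + j \<le> 4 then c i j else 0)" for c
    unfolding scaled_poly_00 fun_eq_iff
    by (clarify, rule sum.mono_neutral_cong_left) (auto split: if_splits)
  have "Pspace 4 = {p. \<exists>c. p = (\<lambda>(s, t). \<Sum>(i, j)\<in>?I. c i j * ((s - a) / r) ^ i * ((t - b) / r) ^ j)}"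
    unfolding Pspace_def by (rule scaled_polys) (use fin in auto)
  also have "\<dots> = scaled_poly 0 0 ` {c. \<forall>i j. i + j > 4 \<longrightarrow> c i j = 0}"
  proof (intro equalityI subsetI)
    fix p assume "p \<in> scaled_poly 0 0 ` {c. \<forall>i j. i + j > 4 \<longrightarrow> c i j = 0}"
    then obtain c where c: "\<And>i j. i + j > 4 \<Longrightarrow> c i j = 0" "p = scaled_poly 0 0 c" by auto
    have "(\<lambda>i j. if i + j \<le> 4 then c i j else 0) = c" using c(1) by (auto simp: fun_eq_iff)
    then have "p = (\<lambda>(s, t). \<Sum>(i, j)\<in>?I. c i j * ((s - a) / r) ^ i * ((t - b) / r) ^ j)"
      by (simp only: restrict c(2))
    then show "p \<in> {p. \<exists>c. p = (\<lambda>(s, t). \<Sum>(i, j)\<in>?I. c i j * ((s - a) / r) ^ i * ((t - b) / r) ^ j)}"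
      by blast
  qed (force simp: restrict)
  finally show ?thesis .
qed

lemma scaled_poly_add: "scaled_poly 0 0 (\<lambda>i j. c i j + d i j) = scaled_poly 0 0 c + scaled_poly 0 0 d"
  by (auto simp: scaled_poly_def fun_eq_iff algebra_simps sum.distrib add_divide_distrib)

lemma scaled_poly_scale: "scaled_poly 0 0 (\<lambda>i j. u * c i j) = (\<lambda>z. u * scaled_poly 0 0 c z)"
  by (auto simp: scaled_poly_def fun_eq_iff sum_distrib_left mult.assoc)

lemma Pspace_4_subset: "Pspace 4 \<subseteq> Qspace 4"
  by (auto simp: Pspace_4 Qspace_4)

lemma subspace_Pspace_4: "plane_fun.subspace (Pspace 4)"
proof (rule plane_fun.subspaceI)
  show "0 \<in> Pspace 4"
    unfolding Pspace_4 by (rule image_eqI[of _ _ "\<lambda>_ _. 0"]) (auto simp: scaled_poly_def fun_eq_iff)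
  show "p + q \<in> Pspace 4" if "p \<in> Pspace 4" "q \<in> Pspace 4" for p q
    using that unfolding Pspace_4
    by (auto simp: scaled_poly_add[symmetric] intro!: imageI)
  show "(\<lambda>z. u * p z) \<in> Pspace 4" if "p \<in> Pspace 4" for u p
    using that unfolding Pspace_4
    by (auto simp: scaled_poly_scale[symmetric] intro!: imageI)
qed

lemma subspace_Qspace_4: "plane_fun.subspace (Qspace 4)"
proof (rule plane_fun.subspaceI)
  show "0 \<in> Qspace 4"
    using Pspace_4_subset plane_fun.subspace_0[OF subspace_Pspace_4] by auto
  show "p + q \<in> Qspace 4" if "p \<in> Qspace 4" "q \<in> Qspace 4" for p q
    using that unfolding Qspace_4
    by (auto simp: scaled_poly_add[symmetric])
  show "(\<lambda>z. u * p z) \<in> Qspace 4" if "p \<in> Qspace 4" for u p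
    using that unfolding Qspace_4
    by (auto simp: scaled_poly_scale[symmetric])
qed

text \<open>Additivity is claimed on \<open>Qspace 4\<close> only: \<open>deriv\<close> need not be
  additive on functions that are not differentiable.\<close>

lemma dof_add:
  assumes "m \<in> {1..25}" "p \<in> Qspace 4" "q \<in> Qspace 4"
  shows "dof x m (p + q) = dof x m p + dof x m q"
  using assms unfolding Qspace_4
  by (auto simp: scaled_poly_add[symmetric] dof_scaled_poly ref_dof_add add_divide_distrib)

lemma dof_diff:
  assumes "m \<in> {1..25}" "p \<in> Qspace 4" "q \<in> Qspace 4"
  shows "dof x m (p - q) = dof x m p - dof x m q"
  using dof_add[of m "p - q" q] assms plane_fun.subspace_diff[OF subspace_Qspace_4] by simp

lemma dof_scale:
  assumes "m \<in> {1..25}" "p \<in> Qspace 4"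
  shows "dof x m (\<lambda>z. u * p z) = u * dof x m p"
  using assms unfolding Qspace_4
  by (auto simp: scaled_poly_scale[symmetric] dof_scaled_poly ref_dof_scale)

lemma dof_sum:
  assumes "m \<in> {1..25}" "\<And>n. n \<in> S \<Longrightarrow> f n \<in> Qspace 4"
  shows "dof x m (\<Sum>n\<in>S. f n) = (\<Sum>n\<in>S. dof x m (f n))"
proof -
  \<comment> \<open>This serves the empty sum and also an infinite \<open>S\<close>, for which both
    sums are 0.\<close>
  have "dof x m 0 = 0"
    using dof_scale[OF assms(1), of 0 0] plane_fun.subspace_0[OF subspace_Qspace_4]
    by (simp add: zero_fun_def)
  then show ?thesis
    using assms(2)
  proof (induction S rule: infinite_finite_induct)
    case (insert n S)
    have "dof x m (f n + sum f S) = dof x m (f n) + dof x m (sum f S)"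
      by (rule dof_add[OF assms(1)])
        (use insert.prems in \<open>auto intro!: plane_fun.subspace_sum[OF subspace_Qspace_4]\<close>)
    then show ?case
      using insert by (simp only: sum.insert insert_iff simp_thms)
  qed auto
qed

lemma Q4_eq_0:
  assumes "p \<in> Qspace 4" "\<And>m. m \<in> {1..25} \<Longrightarrow> dof x m p = 0"
  shows "p = 0"
proof -
  obtain c where c: "p = scaled_poly 0 0 c" using assms(1) by (auto simp: Qspace_4)
  have "ref_dof m c = 0" if "m \<in> {1..25}" for m
    using assms(2)[OF that] weight_nonzero by (simp add: c dof_scaled_poly[OF that])
  then have "c i j = 0" if "i \<le> 4" "j \<le> 4" for i j
    using ref_dof_unisolvent that by blast
  then show ?thesis by (auto simp: c scaled_poly_def fun_eq_iff)
qed

lemma P4_eq_0: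
  assumes "p \<in> Pspace 4" "\<And>m. m \<in> P4_dofs \<Longrightarrow> dof x m p = 0"
  shows "p = 0"
proof -
  obtain c where c: "p = scaled_poly 0 0 c" "\<And>i j. i + j > 4 \<Longrightarrow> c i j = 0"
    using assms(1) by (auto simp: Pspace_4)
  have "ref_dof m c = 0" if "m \<in> P4_dofs" for m
  proof -
    have "m \<in> {1..25}" using that by (auto simp: P4_dofs_def)
    then show ?thesis using assms(2)[OF that] weight_nonzero by (simp add: c dof_scaled_poly)
  qed
  then have "c i j = 0" for i j using P4_ref_unisolvent c(2) by blast
  then show ?thesis by (auto simp: c scaled_poly_def fun_eq_iff)
qed

lemma P4_interpolation:
  obtains p where "p \<in> Pspace 4" "\<And>m. m \<in> P4_dofs \<Longrightarrow> dof x m p = v m"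
proof -
  obtain c where c: "\<And>i j. i + j > 4 \<Longrightarrow> c i j = 0" "\<And>m. m \<in> P4_dofs \<Longrightarrow> ref_dof m c = v m * weight m"
    \<comment> \<open>The data are multiplied by the weights that \<open>dof_scaled_poly\<close>
      divides out.\<close>
    using P4_ref_interpolation[of "\<lambda>m. v m * weight m"] by blast
  show ?thesis
  proof
    show "scaled_poly 0 0 c \<in> Pspace 4" unfolding Pspace_4 using c(1) by blast
    show "dof x m (scaled_poly 0 0 c) = v m" if "m \<in> P4_dofs" for m
    proof -
      have "m \<in> {1..25}" using that by (auto simp: P4_dofs_def)
      then show ?thesis using c(2)[OF that] weight_nonzero by (simp add: dof_scaled_poly)
    qed
  qed
qed

lemma bfs_basis:
  assumes "n \<in> {1..25}"
  shows "bfs_basis x n \<in> Qspace 4"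
    and "\<And>m. m \<in> {1..25} \<Longrightarrow> dof x m (bfs_basis x n) = (if m = n then 1 else 0)"
proof -
  let ?P = "\<lambda>q. q \<in> Qspace 4 \<and> (\<forall>m\<in>{1..25}. dof x m q = (if m = n then 1 else 0))"
  have "\<exists>!q. ?P q"
  proof (rule ex_ex1I)
    \<comment> \<open>The witness is the product of two univariate dual quartics;
      \<open>weight n\<close> restores the value 1 after scaling.\<close>
    let ?c = "\<lambda>i j. weight n * (hermite_dual (fst (dof_pair n)) i * hermite_dual (snd (dof_pair n)) j)"
    show "\<exists>q. ?P q"
      by (rule exI[of _ "scaled_poly 0 0 ?c"])
        (use assms weight_nonzero in \<open>auto simp: Qspace_4 dof_scaled_poly ref_dof_scale ref_dof_dual\<close>)
    fix p q assume p: "?P p" and q: "?P q"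
    have "dof x m (p - q) = 0" if "m \<in> {1..25}" for m
      using p q that by (simp add: dof_diff)
    then have "p - q = 0"
      using p q plane_fun.subspace_diff[OF subspace_Qspace_4] Q4_eq_0 by blast
    then show "p = q" by simp
  qed
  then have "?P (bfs_basis x n)" unfolding bfs_basis_def by (rule theI')
  then show "bfs_basis x n \<in> Qspace 4"
    "\<And>m. m \<in> {1..25} \<Longrightarrow> dof x m (bfs_basis x n) = (if m = n then 1 else 0)" by auto
qed

section \<open>The space \<open>V4\<close> and its 24 functionals\<close>

definition added :: "nat set" where
  "added = {5, 6, 7, 8, 12, 14, 17, 18, 20}"

lemma added_subset: "added \<subseteq> {1..25}" and added_finite: "finite added"
  by (auto simp: added_def)

lemma dof_partition: "{1..24} = P4_dofs \<union> added" "P4_dofs \<inter> added = {}"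
proof -
  show "{1..24} = P4_dofs \<union> added"
  proof (intro equalityI subsetI)
    fix m :: nat assume "m \<in> {1..24}"
    then have "m \<in> {1..25}" "m \<noteq> 25" by auto
    then show "m \<in> P4_dofs \<union> added"
      using dof_cases unfolding P4_dofs_def added_def by auto
  qed (auto simp: P4_dofs_def added_def)
qed (auto simp: P4_dofs_def added_def)

definition combine :: "(real \<times> real \<Rightarrow> real) \<Rightarrow> (nat \<Rightarrow> real) \<Rightarrow> real \<times> real \<Rightarrow> real" where
  "combine q u = q + (\<Sum>n\<in>added. (\<lambda>z. u n * bfs_basis x n z))"

text \<open>By duality each added function is seen only by its own functional, which makes the
  system for \<open>q\<close> and \<open>u\<close> block triangular.\<close>

lemma dof_combine:
  assumes "q \<in> Pspace 4" "m \<in> {1..25}"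
  shows "dof x m (combine q u) = dof x m q + (if m \<in> added then u m else 0)"
proof -
  have mem: "(\<lambda>z. u n * bfs_basis x n z) \<in> Qspace 4" if "n \<in> added" for n
    using plane_fun.subspace_scale[OF subspace_Qspace_4] bfs_basis(1) that added_subset by blast
  have "dof x m (combine q u) = dof x m q + (\<Sum>n\<in>added. dof x m (\<lambda>z. u n * bfs_basis x n z))"
    unfolding combine_def using assms Pspace_4_subset mem
    by (subst dof_add) (auto simp: dof_sum intro!: plane_fun.subspace_sum[OF subspace_Qspace_4])
  also have "(\<Sum>n\<in>added. dof x m (\<lambda>z. u n * bfs_basis x n z)) = (\<Sum>n\<in>added. if n = m then u n else 0)"
  proof (rule sum.cong)
    fix n assume "n \<in> added"
    then have "n \<in> {1..25}" using added_subset by blast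
    then show "dof x m (\<lambda>z. u n * bfs_basis x n z) = (if n = m then u n else 0)"
      using assms(2) bfs_basis by (simp add: dof_scale)
  qed simp
  finally show ?thesis using added_finite by simp
qed

text \<open>Span induction adds one multiple of a generator at a time: it is absorbed into
  \<open>q\<close> or into a single coefficient of \<open>u\<close>.\<close>

lemma V4_eq: "V4 x = {combine q u |q u. q \<in> Pspace 4}"
proof (intro equalityI subsetI)
  fix p assume "p \<in> V4 x"
  then have "p \<in> plane_fun.span (Pspace 4 \<union> bfs_basis x ` added)" by (simp add: V4_def added_def)
  then show "p \<in> {combine q u |q u. q \<in> Pspace 4}"
  proof (induction rule: plane_fun.span_induct_alt)
    case base
    have "0 = combine 0 (\<lambda>_. 0)" by (auto simp: combine_def fun_eq_iff)
    then show ?case using plane_fun.subspace_0[OF subspace_Pspace_4] by blast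
  next
    case (step k f p)
    then obtain q u where p: "p = combine q u" and q: "q \<in> Pspace 4" by blast
    from step(1) show ?case
    proof
      assume "f \<in> Pspace 4"
      then have "(\<lambda>z. k * f z) + q \<in> Pspace 4"
        using q plane_fun.subspace_scale[OF subspace_Pspace_4] plane_fun.subspace_add[OF subspace_Pspace_4]
        by blast
      moreover have "(\<lambda>z. k * f z) + p = combine ((\<lambda>z. k * f z) + q) u"
        by (simp add: p combine_def add.assoc)
      ultimately show ?case by blast
    next
      assume "f \<in> bfs_basis x ` added"
      then obtain n where n: "n \<in> added" "f = bfs_basis x n" by blast
      have "(\<lambda>z. k * f z) + p = combine q (u(n := u n + k))"
        using n added_finite
        by (simp add: p combine_def sum.remove[of added n] fun_eq_iff algebra_simps)
      then show ?case using q by blast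
    qed
  qed
next
  fix p assume "p \<in> {combine q u |q u. q \<in> Pspace 4}"
  then show "p \<in> V4 x"
    unfolding V4_def combine_def added_def[symmetric]
    by (auto intro!: plane_fun.span_add plane_fun.span_sum plane_fun.span_scale intro: plane_fun.span_base)
qed

lemma subspace_V4: "plane_fun.subspace (V4 x)"
  unfolding V4_def by (rule plane_fun.subspace_span)

lemma V4_eq_0:
  assumes "p \<in> V4 x" "\<And>m. m \<in> {1..24} \<Longrightarrow> dof x m p = 0"
  shows "p = 0"
proof -
  obtain q u where p: "p = combine q u" and q: "q \<in> Pspace 4" using assms(1) by (auto simp: V4_eq)
  have D: "dof x m q + (if m \<in> added then u m else 0) = 0" if "m \<in> P4_dofs \<union> added" for m
    using assms(2)[of m] dof_combine[OF q, of m u] that[folded dof_partition(1)] p by simp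
  have q0: "q = 0"
  proof (rule P4_eq_0[OF q])
    fix m assume "m \<in> P4_dofs"
    moreover from this have "m \<notin> added" using dof_partition(2) by blast
    ultimately show "dof x m q = 0" using D[of m] by simp
  qed
  have "u m = 0" if "m \<in> added" for m
  proof -
    have "dof x m (0 :: real \<times> real \<Rightarrow> real) = 0"
      \<comment> \<open>The empty sum gives the value of the functional at the zero
        function.\<close>
      using dof_sum[of m "{}"] that added_subset by auto
    then show ?thesis using D[of m] that q0 by simp
  qed
  then show ?thesis by (simp add: p q0 combine_def fun_eq_iff)
qed

lemma V4_subset: "V4 x \<subseteq> Qspace 4"
  unfolding V4_def using Pspace_4_subset bfs_basis(1)
  by (intro plane_fun.span_minimal subspace_Qspace_4) auto

lemma V4_unisolvent: "\<exists>!p. p \<in> V4 x \<and> (\<forall>m\<in>{1..24}. dof x m p = v m)"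
proof (rule ex_ex1I)
  obtain q where q: "q \<in> Pspace 4" "\<And>m. m \<in> P4_dofs \<Longrightarrow> dof x m q = v m"
    using P4_interpolation by blast
  \<comment> \<open>The coefficients are the residuals that \<open>q\<close> leaves at the nine
    added functionals.\<close>
  let ?p = "combine q (\<lambda>n. v n - dof x n q)"
  have "dof x m ?p = v m" if "m \<in> {1..24}" for m
  proof -
    have "m \<in> {1..25}" using that by auto
    then show ?thesis
      using that[unfolded dof_partition(1)] q by (auto simp: dof_combine)
  qed
  then show "\<exists>p. p \<in> V4 x \<and> (\<forall>m\<in>{1..24}. dof x m p = v m)"
    using q(1) unfolding V4_eq by blast
next
  fix p q
  assume p: "p \<in> V4 x \<and> (\<forall>m\<in>{1..24}. dof x m p = v m)"
    and q: "q \<in> V4 x \<and> (\<forall>m\<in>{1..24}. dof x m q = v m)"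
  have "p - q = 0"
  proof (rule V4_eq_0)
    show "p - q \<in> V4 x" using p q plane_fun.subspace_diff[OF subspace_V4] by blast
    fix m :: nat assume m: "m \<in> {1..24}"
    show "dof x m (p - q) = 0"
      using m p q V4_subset by (subst dof_diff) auto
  qed
  then show "p = q" by simp
qed

end

theorem lemma2p2:
  fixes T :: "(real \<times> real) set" and x :: "nat \<Rightarrow> real \<times> real"
  assumes "square_with_vertices T x"
  shows "\<forall>v :: nat \<Rightarrow> real. \<exists>!p. p \<in> V4 x \<and> (\<forall>m\<in>{1..24}. dof x m p = v m)"
proof -
  obtain a b h where "h > 0" "x 1 = (a, b)" "x 2 = (a + h, b)" "x 3 = (a + h, b + h)" "x 4 = (a, b + h)"
    using assms unfolding square_with_vertices_def by blast
  \<comment> \<open>With half the side as unit, vertices and midpoints get the coordinates 0, 1 and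
    2.\<close>
  then interpret bfs_square x a b "h / 2"
    by unfold_locales auto
  show ?thesis using V4_unisolvent by blast
qed

end
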